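(* Let $(M,N)$ be a pair of nonempty subsets of a Fréchet smooth real Banach space $B$, with $N$ compact and $M$ $\phi$-approximatively compact with respect to $N$. Then the pair $(M_0,N_0)$ is nonempty, i.e. both $M_0\ne\emptyset$ and $N_0\neq\emptyset$.
   Context: $B$ is Fréchet smooth if its norm is Fréchet differentiable at every nonzero point (in particular $B$ is smooth). $J:B\to B^*$ is the (single-valued) normalized duality mapping: $\langle u,Ju\rangle=\|u\|^2=\|Ju\|^2$. Define $\phi(u,v)=\|u\|^2-2\langle u,Jv\rangle+\|v\|^2$, $\mathrm{dist}_\phi(M,N)=\inf\{\phi(u,v):u\in M,v\in N\}$, $M_0=\{u\in M:\phi(u,v)=\mathrm{dist}_\phi(M,N)\text{ for some }v\in N\}$ and $N_0=\{v\in N:\phi(u,v)=\mathrm{dist}_\phi(M,N)\text{ for some }u\in M\}$. $M$ is $\phi$-approximatively compact with respect to $N$ if every sequence $\{u_n\}$ in $M$ for which there is some $v\in N$ with $\phi(u_n,v)\to\inf_{w\in M}\phi(w,v)$ has a subsequence converging in norm to an element of $M$. *)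

theory Defs
  imports "HOL-Analysis.Analysis"
begin

definition frechet_smooth :: "'a::real_normed_vector itself \<Rightarrow> bool"
  where "frechet_smooth _ \<longleftrightarrow>
    (\<forall>x::'a. x \<noteq> 0 \<longrightarrow> (norm :: 'a \<Rightarrow> real) differentiable (at x))"

definition is_duality_image :: "'a::real_normed_vector \<Rightarrow> ('a \<Rightarrow>\<^sub>L real) \<Rightarrow> bool"
  where "is_duality_image v f \<longleftrightarrow>
    blinfun_apply f v = (norm v)\<^sup>2 \<and> (norm v)\<^sup>2 = (norm f)\<^sup>2"

text \<open>The description operator is meaningful on a Frechet smooth space, where the normalized
  duality mapping is single-valued: see \<open>duality_map_unique\<close> and \<open>duality_map\<close> below.\<close>

definition duality_map :: "'a::real_normed_vector \<Rightarrow> ('a \<Rightarrow>\<^sub>L real)"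
  where "duality_map v = (THE f. is_duality_image v f)"

definition phi :: "'a::real_normed_vector \<Rightarrow> 'a \<Rightarrow> real"
  where "phi u v = (norm u)\<^sup>2 - 2 * blinfun_apply (duality_map v) u + (norm v)\<^sup>2"

definition dist_phi :: "'a::real_normed_vector set \<Rightarrow> 'a set \<Rightarrow> real"
  where "dist_phi M N = Inf {phi u v | u v. u \<in> M \<and> v \<in> N}"

definition prox_fst :: "'a::real_normed_vector set \<Rightarrow> 'a set \<Rightarrow> 'a set"
  where "prox_fst M N = {u \<in> M. \<exists>v\<in>N. phi u v = dist_phi M N}"

definition prox_snd :: "'a::real_normed_vector set \<Rightarrow> 'a set \<Rightarrow> 'a set"
  where "prox_snd M N = {v \<in> N. \<exists>u\<in>M. phi u v = dist_phi M N}"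

definition phi_approx_compact :: "'a::real_normed_vector set \<Rightarrow> 'a set \<Rightarrow> bool"
  where "phi_approx_compact M N \<longleftrightarrow>
    (\<forall>u::nat \<Rightarrow> 'a. (\<forall>n. u n \<in> M) \<and>
        (\<exists>v\<in>N. (\<lambda>n. phi (u n) v) \<longlonglongrightarrow> (INF w\<in>M. phi w v)) \<longrightarrow>
      (\<exists>l\<in>M. \<exists>r::nat \<Rightarrow> nat. strict_mono r \<and> (u \<circ> r) \<longlonglongrightarrow> l))"

lemma blinfun_apply_le_norm: "blinfun_apply f x \<le> norm f * norm x"
  for f :: "'a::real_normed_vector \<Rightarrow>\<^sub>L real"
  using norm_blinfun[of f x] by simp

lemma duality_map_unique:
  fixes v :: "'a::real_normed_vector"
  assumes "frechet_smooth TYPE('a)"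
  shows "\<exists>!f. is_duality_image v f"
proof (cases "v = 0")
  case True
  then show ?thesis by (auto simp: is_duality_image_def)
next
  case False
  then obtain D where D: "((norm :: 'a \<Rightarrow> real) has_derivative D) (at v)"
    using assms by (auto simp: frechet_smooth_def differentiable_def)
  then have bl: "bounded_linear D" by (rule has_derivative_bounded_linear)
  have dir: "((\<lambda>t. norm (v + t *\<^sub>R h)) has_real_derivative D h) (at 0)" for h
  proof -
    have "((\<lambda>t. norm (v + t *\<^sub>R h)) has_derivative (\<lambda>t. D (t *\<^sub>R h))) (at 0)"
    proof -
      have "((\<lambda>t. v + t *\<^sub>R h) has_derivative (\<lambda>t. t *\<^sub>R h)) (at 0)"
        by (auto intro!: derivative_eq_intros)
      from has_derivative_compose[OF this, of norm D] D show ?thesis by simp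
    qed
    then show ?thesis
      unfolding has_field_derivative_def
      using bl by (simp add: linear_simps(5)[OF bl] mult.commute[of _ "D h"])
  qed
  have dq: "((\<lambda>t. (norm (v + t *\<^sub>R h) - norm v) / t) \<longlongrightarrow> D h) (at 0)" for h
    using DERIV_D[OF dir[of h]] by simp
  have Dle: "norm (D h) \<le> 1 * norm h" for h
  proof -
    have "((\<lambda>t. norm ((norm (v + t *\<^sub>R h) - norm v) / t)) \<longlongrightarrow> norm (D h)) (at 0)"
      by (intro tendsto_norm dq)
    moreover have "\<forall>\<^sub>F t in at 0. norm ((norm (v + t *\<^sub>R h) - norm v) / t) \<le> norm h"
    proof -
      have "norm ((norm (v + t *\<^sub>R h) - norm v) / t) \<le> norm h" if "t \<noteq> 0" for t :: real
        using norm_triangle_ineq3[of "v + t *\<^sub>R h" v] that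
        by (simp add: divide_simps mult.commute)
      then show ?thesis by (auto simp: eventually_at_filter)
    qed
    ultimately show ?thesis by (simp add: tendsto_upperbound)
  qed
  have Dv: "D v = norm v"
  proof -
    have "\<forall>\<^sub>F t in at (0::real). t \<in> {-1<..<1} - {0}"
      by (rule eventually_at_in_open) auto
    then have "\<forall>\<^sub>F t in at 0. (norm (v + t *\<^sub>R v) - norm v) / t = norm v"
    proof (rule eventually_mono)
      fix t :: real assume t: "t \<in> {-1<..<1} - {0}"
      have "v + t *\<^sub>R v = (1 + t) *\<^sub>R v" by (simp add: algebra_simps)
      with t have "norm (v + t *\<^sub>R v) = (1 + t) * norm v" by simp
      with t show "(norm (v + t *\<^sub>R v) - norm v) / t = norm v"
        by (simp add: field_simps)
    qed
    then have "((\<lambda>t. (norm (v + t *\<^sub>R v) - norm v) / t) \<longlongrightarrow> norm v) (at 0)"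
      by (rule tendsto_eventually)
    with dq[of v] show ?thesis by (rule LIM_unique)
  qed
  define E where "E = Blinfun D"
  have E: "blinfun_apply E = D" unfolding E_def by (rule bounded_linear_Blinfun_apply[OF bl])
  have "norm E \<le> 1" by (rule norm_blinfun_bound) (use Dle E in auto)
  moreover have "1 \<le> norm E"
    using blinfun_apply_le_norm[of E v] E Dv False by simp
  ultimately have nE: "norm E = 1" by simp
  show ?thesis
  proof (rule ex1I[of _ "norm v *\<^sub>R E"])
    show "is_duality_image v (norm v *\<^sub>R E)"
      by (simp add: is_duality_image_def scaleR_blinfun.rep_eq E Dv nE power2_eq_square)
  next
    fix g assume g: "is_duality_image v g"
    then have ng: "norm g = norm v" by (auto simp: is_duality_image_def)
    have "(\<lambda>h. norm v * D h - g h) = (\<lambda>h. 0)"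
    proof (rule has_derivative_local_min)
      show "((\<lambda>y. norm v * norm y - g y) has_derivative (\<lambda>h. norm v * D h - g h)) (at v)"
        by (intro has_derivative_diff has_derivative_mult_right D
            bounded_linear_imp_has_derivative blinfun.bounded_linear_right)
      have "norm v * norm v - g v \<le> norm v * norm y - g y" for y
        using blinfun_apply_le_norm[of g y] g ng
        by (simp add: is_duality_image_def power2_eq_square)
      then show "\<forall>\<^sub>F y in at v. norm v * norm v - g v \<le> norm v * norm y - g y"
        by simp
    qed
    then have "norm v * D h - g h = 0" for h by (rule fun_cong)
    then show "g = norm v *\<^sub>R E"
      by (intro blinfun_eqI) (simp add: scaleR_blinfun.rep_eq E)
  qed
qed

lemma duality_map:
  fixes v :: "'a::real_normed_vector"
  assumes "frechet_smooth TYPE('a)"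
  shows "is_duality_image v (duality_map v)"
  unfolding duality_map_def by (rule theI'[OF duality_map_unique[OF assms]])

end

theory Submission
  imports Defs
begin

text \<open>On a Frechet smooth space the function \<open>x \<mapsto> (norm x)\<^sup>2 / 2\<close> is Frechet differentiable
  everywhere with derivative \<open>J\<close>, and \<open>J w\<close> is a subgradient of it at every \<open>w\<close>. Combining the two
  (Smulian's argument) shows that \<open>J\<close> is norm-to-norm continuous. Hence, for a sequence
  \<open>(u\<^sub>n, v\<^sub>n)\<close> minimizing \<open>\<phi>\<close> whose second component converges to \<open>v \<in> N\<close>, the sequence
  \<open>u\<^sub>n\<close> is bounded and \<open>\<phi>(u\<^sub>n, v)\<close> tends to the same infimum, so that approximative compactness
  applies to \<open>u\<^sub>n\<close> and \<open>v\<close>.\<close>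

lemma
  fixes v :: "'a::real_normed_vector"
  assumes "frechet_smooth TYPE('a)"
  shows duality_map_self: "blinfun_apply (duality_map v) v = (norm v)\<^sup>2"
    and norm_duality_map: "norm (duality_map v) = norm v"
  using duality_map[OF assms, of v] by (auto simp: is_duality_image_def)

lemma duality_map_le:
  fixes v :: "'a::real_normed_vector"
  assumes "frechet_smooth TYPE('a)"
  shows "blinfun_apply (duality_map v) u \<le> norm v * norm u"
  using blinfun_apply_le_norm[of "duality_map v" u] norm_duality_map[OF assms, of v] by simp

lemma duality_map_subgradient:
  fixes w :: "'a::real_normed_vector"
  assumes "frechet_smooth TYPE('a)"
  shows "blinfun_apply (duality_map w) (y - w) \<le> (norm y)\<^sup>2 / 2 - (norm w)\<^sup>2 / 2"
proof -
  have "0 \<le> (norm y - norm w)\<^sup>2" by simp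
  then show ?thesis
    using duality_map_le[OF assms, of w y] duality_map_self[OF assms, of w]
    by (simp add: blinfun.diff_right power2_diff mult.commute)
qed

text \<open>Some derivative exists: away from 0 by the power rule, at 0 because the square is of
  smaller order than the norm. By the subgradient inequality, half the squared norm minus
  \<open>duality_map v\<close> is minimal at \<open>v\<close>, so its derivative vanishes there,
  which identifies \<open>F\<close>.\<close>

lemma has_derivative_half_norm_power2:
  fixes v :: "'a::real_normed_vector"
  assumes "frechet_smooth TYPE('a)"
  shows "((\<lambda>x. (norm x)\<^sup>2 / 2) has_derivative blinfun_apply (duality_map v)) (at v)"
proof -
  have "\<exists>F. ((\<lambda>x::'a. (norm x)\<^sup>2 / 2) has_derivative F) (at v)"
  proof (cases "v = 0")
    case True
    have "((\<lambda>x::'a. (norm x)\<^sup>2 / 2) has_derivative (\<lambda>x. 0)) (at 0)"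
      unfolding has_derivative_at
    proof (intro conjI bounded_linear_zero)
      \<comment> \<open>For nonzero \<open>h\<close> the difference quotient equals
        \<open>norm h / 2\<close>.\<close>
      have "((\<lambda>h::'a. norm h / 2) \<longlongrightarrow> 0) (at 0)" by (auto intro!: tendsto_eq_intros)
      then show "(\<lambda>h::'a. norm ((norm (0 + h))\<^sup>2 / 2 - (norm (0::'a))\<^sup>2 / 2 - 0) / norm h) \<midarrow>0\<rightarrow> 0"
        by (rule Lim_transform_eventually)
          (auto simp: eventually_at_filter power2_eq_square)
    qed
    with True show ?thesis by blast
  next
    case False
    then obtain D where "((norm :: 'a \<Rightarrow> real) has_derivative D) (at v)"
      using assms by (auto simp: frechet_smooth_def differentiable_def)
    from has_derivative_divide'[OF has_derivative_power[OF this, of 2]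
        has_derivative_const[of 2]] show ?thesis by auto
  qed
  then obtain F where F: "((\<lambda>x::'a. (norm x)\<^sup>2 / 2) has_derivative F) (at v)" by blast
  have "(\<lambda>h. F h - duality_map v h) = (\<lambda>h. 0)"
  proof (rule has_derivative_local_min)
    show "((\<lambda>y. (norm y)\<^sup>2 / 2 - duality_map v y) has_derivative
        (\<lambda>h. F h - duality_map v h)) (at v)"
      by (intro has_derivative_diff F bounded_linear_imp_has_derivative
          blinfun.bounded_linear_right)
    show "\<forall>\<^sub>F y in at v. (norm v)\<^sup>2 / 2 - duality_map v v \<le> (norm y)\<^sup>2 / 2 - duality_map v y"
    proof (intro always_eventually allI)
      show "(norm v)\<^sup>2 / 2 - duality_map v v \<le> (norm y)\<^sup>2 / 2 - duality_map v y" for y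
        using duality_map_subgradient[OF assms, of v y] by (simp add: blinfun.diff_right)
    qed
  qed
  then have "F = blinfun_apply (duality_map v)" by (simp add: fun_eq_iff)
  with F show ?thesis by simp
qed

text \<open>By homogeneity one sphere suffices, and a one-sided bound suffices because
  \<open>x\<close> and \<open>- x\<close> can both be tested. The radius is free since
  differentiability gives estimates only on a small ball.\<close>

lemma norm_blinfun_le_of_sphere:
  fixes f :: "'a::real_normed_vector \<Rightarrow>\<^sub>L real"
  assumes "0 < d" "0 \<le> c" and le: "\<And>h. norm h = d \<Longrightarrow> blinfun_apply f h \<le> c * d"
  shows "norm f \<le> c"
proof (rule norm_blinfun_bound)
  fix x
  show "norm (blinfun_apply f x) \<le> c * norm x"
  proof (cases "x = 0")
    case False
    have "blinfun_apply f y \<le> c * norm y" if "y \<noteq> 0" for y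
      using le[of "(d / norm y) *\<^sub>R y"] that \<open>0 < d\<close>
      by (simp add: blinfun.scaleR_right field_simps)
    from this[of x] this[of "- x"] False show ?thesis
      by (simp add: blinfun.minus_right abs_le_iff)
  qed simp
qed fact

lemma isCont_duality_map:
  fixes v :: "'a::real_normed_vector"
  assumes fs: "frechet_smooth TYPE('a)"
  shows "isCont duality_map v"
  unfolding isCont_def tendsto_iff
proof (intro allI impI)
  fix e :: real assume "0 < e"
  \<comment> \<open>Two errors of size \<open>c * d\<close> on the sphere of radius \<open>d\<close>
    will give the norm bound \<open>2 * c\<close>, strictly below \<open>e\<close>.\<close>
  define c where "c = e / 3"
  have "0 < c" using \<open>0 < e\<close> by (simp add: c_def)
  let ?g = "\<lambda>x::'a. (norm x)\<^sup>2 / 2"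
  from has_derivative_half_norm_power2[OF fs, of v, unfolded has_derivative_at_alt] \<open>0 < c\<close>
  obtain d0 where "0 < d0" and
    d0: "\<And>y. norm (y - v) < d0 \<Longrightarrow>
      norm (?g y - ?g v - duality_map v (y - v)) \<le> c * norm (y - v)"
    by blast
  define d where "d = d0 / 2"
  have "0 < d" "d < d0" using \<open>0 < d0\<close> by (auto simp: d_def)
  \<comment> \<open>The radius \<open>d\<close> is fixed before \<open>w\<close> moves, so this
    error eventually drops below \<open>c * d\<close>.\<close>
  have "((\<lambda>w. ?g v - ?g w + norm w * norm (w - v)) \<longlongrightarrow> 0) (at v)"
    by (auto intro!: tendsto_eq_intros)
  then have "\<forall>\<^sub>F w in at v. ?g v - ?g w + norm w * norm (w - v) < c * d"
    by (rule order_tendstoD) (use \<open>0 < c\<close> \<open>0 < d\<close> in simp)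
  then show "\<forall>\<^sub>F w in at v. dist (duality_map w) (duality_map v) < e"
  proof (rule eventually_mono)
    fix w assume w: "?g v - ?g w + norm w * norm (w - v) < c * d"
    have "norm (duality_map w - duality_map v) \<le> 2 * c"
    proof (rule norm_blinfun_le_of_sphere[OF \<open>0 < d\<close>])
      fix h :: 'a assume h: "norm h = d"
      \<comment> \<open>Split \<open>v + h - w\<close> as \<open>h - (w - v)\<close>: the
        subgradient inequality at \<open>w\<close> bounds \<open>duality_map w h\<close>, and
        differentiability at \<open>v\<close> controls the increment of \<open>?g\<close> from
        \<open>v\<close> to \<open>v + h\<close>.\<close>
      have "duality_map w (v + h - w) \<le> ?g (v + h) - ?g w"
        by (rule duality_map_subgradient[OF fs])
      moreover have "duality_map w (w - v) \<le> norm w * norm (w - v)"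
        by (rule duality_map_le[OF fs])
      moreover have "?g (v + h) - ?g v - duality_map v h \<le> c * d"
        using d0[of "v + h"] h \<open>d < d0\<close> by simp
      ultimately show "(duality_map w - duality_map v) h \<le> 2 * c * d"
        using w by (simp add: blinfun.bilinear_simps)
    qed (use \<open>0 < c\<close> in simp)
    then show "dist (duality_map w) (duality_map v) < e"
      using \<open>0 < e\<close> by (simp add: dist_norm c_def)
  qed
qed

text \<open>This coercivity estimate bounds \<open>phi\<close> below, as the infima require, and
  lets \<open>phi\<close> and \<open>norm v\<close> control \<open>norm u\<close>.\<close>

lemma power2_norm_diff_le_phi:
  fixes u v :: "'a::real_normed_vector"
  assumes "frechet_smooth TYPE('a)"
  shows "(norm u - norm v)\<^sup>2 \<le> phi u v"
  using duality_map_le[OF assms, of v u] by (simp add: phi_def power2_diff mult.commute)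

lemma phi_nonneg:
  fixes u v :: "'a::real_normed_vector"
  assumes "frechet_smooth TYPE('a)"
  shows "0 \<le> phi u v"
  using power2_norm_diff_le_phi[OF assms, of u v] by (meson order_trans zero_le_power2)

lemma dist_phi_le:
  fixes M N :: "'a::real_normed_vector set"
  assumes "frechet_smooth TYPE('a)" "u \<in> M" "v \<in> N"
  shows "dist_phi M N \<le> phi u v"
  unfolding dist_phi_def
  by (rule cInf_lower) (use assms phi_nonneg[OF assms(1)] in \<open>auto intro!: bdd_belowI[of _ 0]\<close>)

lemma dist_phi_minimizing_sequence:
  fixes M N :: "'a::real_normed_vector set"
  assumes "frechet_smooth TYPE('a)" "M \<noteq> {}" "N \<noteq> {}"
  obtains u v :: "nat \<Rightarrow> 'a"
  where "\<And>n. u n \<in> M" "\<And>n. v n \<in> N" "(\<lambda>n. phi (u n) (v n)) \<longlonglongrightarrow> dist_phi M N"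
proof -
  let ?S = "{phi u v | u v. u \<in> M \<and> v \<in> N}"
  have "dist_phi M N \<in> closure ?S"
    unfolding dist_phi_def
    by (rule closure_contains_Inf)
      (use assms phi_nonneg[OF assms(1)] in \<open>auto intro!: bdd_belowI[of _ 0]\<close>)
  then obtain x where x: "\<And>n. x n \<in> ?S" "x \<longlonglongrightarrow> dist_phi M N"
    by (auto simp: closure_sequential)
  from x(1) have "\<forall>n. \<exists>u v. u \<in> M \<and> v \<in> N \<and> x n = phi u v" by blast
  then obtain u v where uv: "\<And>n. u n \<in> M" "\<And>n. v n \<in> N" "\<And>n. x n = phi (u n) (v n)"
    by metis
  from uv(3) have "x = (\<lambda>n. phi (u n) (v n))" by (rule ext)
  with uv(1,2) x(2) show ?thesis by (intro that[of u v]) auto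
qed

text \<open>The squared norms of \<open>u n\<close> cancel. What remains is a null sequence of
  functionals applied to a bounded sequence, plus a difference of squared norms tending to
  0.\<close>

lemma tendsto_phi_diff_snd:
  fixes u v :: "nat \<Rightarrow> 'a::real_normed_vector"
  assumes fs: "frechet_smooth TYPE('a)" and "Bseq u" and v: "v \<longlonglongrightarrow> l"
  shows "(\<lambda>n. phi (u n) l - phi (u n) (v n)) \<longlonglongrightarrow> 0"
proof -
  have "(\<lambda>n. duality_map (v n) - duality_map l) \<longlonglongrightarrow> 0"
    using isCont_tendsto_compose[OF isCont_duality_map[OF fs] v] by (simp add: LIM_zero)
  then have "(\<lambda>n. (duality_map (v n) - duality_map l) (u n)) \<longlonglongrightarrow> 0"
    using bounded_bilinear.Zfun_prod_Bfun[OF bounded_bilinear_blinfun_apply _ \<open>Bseq u\<close>]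
    by (simp add: tendsto_Zfun_iff)
  then have "(\<lambda>n. 2 * (duality_map (v n) - duality_map l) (u n) + ((norm l)\<^sup>2 - (norm (v n))\<^sup>2))
      \<longlonglongrightarrow> 2 * 0 + ((norm l)\<^sup>2 - (norm l)\<^sup>2)"
    by (intro tendsto_intros v)
  then show ?thesis by (simp add: phi_def blinfun.diff_left algebra_simps)
qed

lemma Bseq_fst_of_phi:
  fixes u v :: "nat \<Rightarrow> 'a::real_normed_vector"
  assumes fs: "frechet_smooth TYPE('a)"
    and "Bseq v" and "Bseq (\<lambda>n. phi (u n) (v n))"
  shows "Bseq u"
proof -
  obtain B where B: "\<And>n. norm (v n) \<le> B" using \<open>Bseq v\<close> by (auto simp: Bseq_def)
  obtain C where C: "\<And>n. norm (phi (u n) (v n)) \<le> C" using assms(3) by (auto simp: Bseq_def)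
  have "norm (u n) \<le> B + sqrt C" for n
  proof -
    have "(norm (u n) - norm (v n))\<^sup>2 \<le> C"
      using power2_norm_diff_le_phi[OF fs, of "u n" "v n"] C[of n] by simp
    then have "norm (u n) - norm (v n) \<le> sqrt C" by (rule real_le_rsqrt)
    with B[of n] show ?thesis by simp
  qed
  then show ?thesis by (rule BseqI')
qed

theorem proposition2p12:
  fixes M N :: "'a::banach set"
  assumes "frechet_smooth TYPE('a)"
    and "M \<noteq> {}" and "N \<noteq> {}"
    and "compact N"
    and "phi_approx_compact M N"
  shows "prox_fst M N \<noteq> {} \<and> prox_snd M N \<noteq> {}"
proof -
  note fs = assms(1)
  let ?d = "dist_phi M N"
  obtain u' v' where uv': "\<And>n. u' n \<in> M" "\<And>n. v' n \<in> N" "(\<lambda>n. phi (u' n) (v' n)) \<longlonglongrightarrow> ?d"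
    using dist_phi_minimizing_sequence[OF assms(1-3)] by blast
  obtain v r where "v \<in> N" and r: "strict_mono r" and lim: "(v' \<circ> r) \<longlonglongrightarrow> v"
    using \<open>compact N\<close> uv'(2) unfolding compact_def by blast
  define u where "u = u' \<circ> r"
  have uM: "u n \<in> M" for n by (simp add: u_def uv'(1))
  have conv: "(\<lambda>n. phi (u n) ((v' \<circ> r) n)) \<longlonglongrightarrow> ?d"
    using LIMSEQ_subseq_LIMSEQ[OF uv'(3) r] by (simp add: u_def o_def)
  have "Bseq u"
    by (rule Bseq_fst_of_phi[OF fs convergent_imp_Bseq[OF convergentI[OF lim]]
        convergent_imp_Bseq[OF convergentI[OF conv]]])
  from tendsto_add[OF tendsto_phi_diff_snd[OF fs this lim] conv]
  have phi_lim: "(\<lambda>n. phi (u n) v) \<longlonglongrightarrow> ?d" by simp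
  \<comment> \<open>Approximative compactness refers to the infimum for the fixed \<open>v\<close>.
    It lies below every \<open>phi (u n) v\<close>, hence below their limit, and above
    \<open>?d\<close>, an infimum over more pairs.\<close>
  have "(INF w\<in>M. phi w v) = ?d"
  proof (rule antisym)
    have "(INF w\<in>M. phi w v) \<le> phi (u n) v" for n
      by (rule cINF_lower) (use uM phi_nonneg[OF fs] in \<open>auto intro!: bdd_belowI[of _ 0]\<close>)
    with phi_lim show "(INF w\<in>M. phi w v) \<le> ?d" by (intro LIMSEQ_le_const) auto
    show "?d \<le> (INF w\<in>M. phi w v)"
      using dist_phi_le[OF fs] \<open>M \<noteq> {}\<close> \<open>v \<in> N\<close> by (intro cINF_greatest)
  qed
  with phi_lim uM \<open>v \<in> N\<close> obtain l s
    where "l \<in> M" and s: "strict_mono s" and l: "(u \<circ> s) \<longlonglongrightarrow> l"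
    using assms(5) unfolding phi_approx_compact_def by metis
  \<comment> \<open>With \<open>v\<close> fixed, \<open>phi\<close> is continuous in its first
    argument, so the pair of \<open>l\<close> and \<open>v\<close> attains \<open>?d\<close> and
    witnesses both claims.\<close>
  have "(\<lambda>n. phi ((u \<circ> s) n) v) \<longlonglongrightarrow> phi l v"
    unfolding phi_def by (intro tendsto_intros l)
  moreover have "(\<lambda>n. phi ((u \<circ> s) n) v) \<longlonglongrightarrow> ?d"
    using LIMSEQ_subseq_LIMSEQ[OF phi_lim s] by (simp add: o_def)
  ultimately have "phi l v = ?d" by (rule LIMSEQ_unique)
  with \<open>l \<in> M\<close> \<open>v \<in> N\<close> show ?thesis by (auto simp: prox_fst_def prox_snd_def)
qed

end
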